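(* The Wilcoxon--Mann--Whitney test is detection coherent when restricted to domains where $(F_1,F_2)$ form a monotone likelihood ratio (MLR) family. That is, let $\mathcal R_{MLR}$ be the domain of distribution pairs $(F_1,F_2)$ forming MLR families, $\mathcal H_0=\{(F_1,F_2):F_1=F_2\}$ and $\mathcal D_0=\{(F_1,F_2):\mathrm{AUC}=1/2\}$. Then the domain-restricted blind spot is empty: $$\mathcal S_{\mathcal R_{MLR}}=(\mathcal D_0\setminus\mathcal H_0)\cap\mathcal R_{MLR}=\emptyset ;$$ equivalently, $\{(F_1,F_2):F_1\ne F_2\}\cap\mathcal R_{MLR}=\{(F_1,F_2):\mathrm{AUC}\neq1/2\}\cap\mathcal R_{MLR}$.
   Context: For independent $X_1\sim F_1$ and $X_2\sim F_2$, $\mathrm{AUC}=P(X_1<X_2)+\tfrac12P(X_1=X_2)$. A parametric family of densities $\{f_\theta:\theta\in\Theta\}$ has monotone likelihood ratio if $f_{\theta_2}(x)/f_{\theta_1}(x)$ is monotone in $x$ for all $\theta_1<\theta_2$. The Wilcoxon--Mann--Whitney test is calibrated under the null $\mathcal H_0$. Its detector is the empirical AUC, and its detection functional (the probability limit of the detector) is $\mathrm{AUC}$, whose common value on $\mathcal H_0$ is $1/2$. Its detection-null set, the set of pairs at which the detection functional takes this null value, is $\mathcal D_0$. A test is detection coherent with respect to a domain $\mathcal R$ if its restricted blind spot $\mathcal S_{\mathcal R}=(\mathcal D_0\setminus\mathcal H_0)\cap\mathcal R$ is empty. *)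

theory Defs
  imports "HOL-Probability.Probability"
begin

definition distribution_pairs :: "(real measure \<times> real measure) set" where
  "distribution_pairs = {(F1, F2). real_distribution F1 \<and> real_distribution F2}"

definition auc :: "real measure \<times> real measure \<Rightarrow> real" where
  "auc F = measure (fst F \<Otimes>\<^sub>M snd F) {(x, y). x < y}
         + 1 / 2 * measure (fst F \<Otimes>\<^sub>M snd F) {(x, y). x = y}"

lemma (in prob_space) auc_indep_var:
  assumes "indep_var borel X1 borel X2"
  shows "auc (distr M borel X1, distr M borel X2)
       = prob {\<omega> \<in> space M. X1 \<omega> < X2 \<omega>} + 1 / 2 * prob {\<omega> \<in> space M. X1 \<omega> = X2 \<omega>}"
proof -
  have [measurable]: "random_variable borel X1" "random_variable borel X2"
    and joint: "distr M borel X1 \<Otimes>\<^sub>M distr M borel X2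
      = distr M (borel \<Otimes>\<^sub>M borel) (\<lambda>\<omega>. (X1 \<omega>, X2 \<omega>))"
    using assms by (auto simp: indep_var_distribution_eq)
  have eq: "measure (distr M borel X1 \<Otimes>\<^sub>M distr M borel X2) {(x, y). R x y}
      = prob {\<omega> \<in> space M. R (X1 \<omega>) (X2 \<omega>)}"
    if "{(x, y). R x y} \<in> sets (borel \<Otimes>\<^sub>M borel)" for R
    unfolding joint by (subst measure_distr) (auto intro!: arg_cong[where f = prob] that)
  have "{(x::real, y). x < y} \<in> sets (borel \<Otimes>\<^sub>M borel)"
    "{(x::real, y). x = y} \<in> sets (borel \<Otimes>\<^sub>M borel)"
    unfolding borel_prod case_prod_beta
    by (intro borel_open borel_closed open_Collect_less closed_Collect_eq continuous_intros)+
  then show ?thesis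
    by (simp add: auc_def eq)
qed

text \<open>
  A detector maps the sample sizes \<open>m\<close> and \<open>n\<close> and two samples to a real number.
  The samples are given as infinite sequences, of which only the first \<open>m\<close> and the first
  \<open>n\<close> entries are to be used.
\<close>

type_synonym detector = "nat \<Rightarrow> nat \<Rightarrow> (nat \<Rightarrow> real) \<Rightarrow> (nat \<Rightarrow> real) \<Rightarrow> real"

definition empirical_auc :: detector where
  "empirical_auc m n x y =
     (\<Sum>i<m. \<Sum>j<n. if x i < y j then 1 else if x i = y j then 1 / 2 else 0) / (real m * real n)"

text \<open>
  The law of two independent i.i.d. samples. Whether a detector converges in probability depends
  only on this law, so the limit can be taken on this canonical probability space.
\<close>

definition sample_space ::
    "real measure \<times> real measure \<Rightarrow> ((nat \<Rightarrow> real) \<times> (nat \<Rightarrow> real)) measure" where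
  "sample_space F = (\<Pi>\<^sub>M i\<in>UNIV. fst F) \<Otimes>\<^sub>M (\<Pi>\<^sub>M j\<in>UNIV. snd F)"

text \<open>
  Convergence in probability to \<open>c\<close> as both sample sizes tend to infinity, with no condition on
  their ratio. Measurability is required because \<^const>\<open>measure\<close> vanishes on
  nonmeasurable sets.
\<close>

definition probability_limit :: "detector \<Rightarrow> real measure \<times> real measure \<Rightarrow> real \<Rightarrow> bool" where
  "probability_limit D F c \<longleftrightarrow>
     (\<forall>m n. (\<lambda>(x, y). D m n x y) \<in> borel_measurable (sample_space F)) \<and>
     (\<forall>\<epsilon>>0. ((\<lambda>(m, n). measure (sample_space F)
                 {(x, y) \<in> space (sample_space F). \<bar>D m n x y - c\<bar> > \<epsilon>}) \<longlongrightarrow> 0)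
              (sequentially \<times>\<^sub>F sequentially))"

definition detection_functional ::
    "detector \<Rightarrow> (real measure \<times> real measure \<Rightarrow> real) \<Rightarrow> bool" where
  "detection_functional D T \<longleftrightarrow> (\<forall>F \<in> distribution_pairs. probability_limit D F (T F))"

definition detection_null_set ::
    "(real measure \<times> real measure \<Rightarrow> real) \<Rightarrow> real \<Rightarrow> (real measure \<times> real measure) set" where
  "detection_null_set T c = {F \<in> distribution_pairs. T F = c}"

definition restricted_blind_spot :: "'a set \<Rightarrow> 'a set \<Rightarrow> 'a set \<Rightarrow> 'a set" where
  "restricted_blind_spot D0 H0 R = (D0 - H0) \<inter> R"

text \<open>
  A test enters through its null hypothesis \<open>H0\<close> and its detector \<open>D\<close>. The detection
  functional \<open>T\<close> is determined on \<^const>\<open>distribution_pairs\<close> by \<open>D\<close>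
  (limits in probability are unique), and its common value \<open>c\<close> on \<open>H0\<close> is determined as
  soon as \<open>H0\<close> contains a distribution pair.
\<close>

definition detection_coherent ::
    "(real measure \<times> real measure) set \<Rightarrow> detector \<Rightarrow> (real measure \<times> real measure) set \<Rightarrow> bool"
  where
  "detection_coherent H0 D R \<longleftrightarrow>
     (\<exists>T c. detection_functional D T \<and> (\<forall>F \<in> H0. T F = c) \<and>
            restricted_blind_spot (detection_null_set T c) H0 R = {})"

definition equality_null :: "(real measure \<times> real measure) set" where
  "equality_null = {(F1, F2) \<in> distribution_pairs. F1 = F2}"

text \<open>
  The likelihood ratio lives on the points where at least one of the two densities is positive,
  and is infinite where only the denominator vanishes; this is what division on
  \<^typ>\<open>ennreal\<close> yields. No common support is assumed.
\<close>

definition mlr_family :: "'p::linorder set \<Rightarrow> ('p \<Rightarrow> real \<Rightarrow> real) \<Rightarrow> bool" where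
  "mlr_family \<Theta> f \<longleftrightarrow>
     (\<forall>s\<in>\<Theta>. \<forall>t\<in>\<Theta>. s < t \<longrightarrow>
        (let A = {x. f s x > 0 \<or> f t x > 0};
             r = (\<lambda>x. ennreal (f t x) / ennreal (f s x))
         in mono_on A r \<or> antimono_on A r))"

text \<open>
  Densities are taken with respect to an arbitrary common sigma-finite measure, so that
  both continuous and discrete families (with ties) are covered.
\<close>

definition mlr_pairs :: "(real measure \<times> real measure) set" where
  "mlr_pairs = {(F1, F2) \<in> distribution_pairs.
     \<exists>\<mu> (f :: nat \<Rightarrow> real \<Rightarrow> real).
       sigma_finite_measure \<mu> \<and> sets \<mu> = sets borel \<and>
       (\<forall>\<theta>\<in>{1, 2}. f \<theta> \<in> borel_measurable borel \<and> (\<forall>x. f \<theta> x \<ge> 0)) \<and>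
       F1 = density \<mu> (\<lambda>x. ennreal (f 1 x)) \<and>
       F2 = density \<mu> (\<lambda>x. ennreal (f 2 x)) \<and>
       mlr_family {1, 2} f}"

end

theory Submission
  imports Defs
begin

text \<open>
  Write \<open>AUC = 1/2 + 1/2 E sgn (Y - X)\<close>. With densities \<open>f\<close>, \<open>g\<close> with respect to
  \<open>\<mu>\<close>, symmetrizing in the two arguments gives
  \<open>2 E sgn (Y - X) = \<integral>\<integral> (f x g y - g x f y) sgn (y - x) d\<mu> d\<mu>\<close>. Under a monotone
  likelihood ratio the integrand has constant sign, so at \<open>AUC = 1/2\<close> it vanishes almost
  everywhere; then \<open>f x g y = g x f y\<close> almost everywhere, and integrating over \<open>y\<close>
  yields \<open>f = g\<close>. That the empirical AUC converges in probability to \<open>AUC\<close> follows from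
  Chebyshev's inequality: two summands of the centred statistic with no common observation are
  uncorrelated, so its second moment is at most \<open>1/m + 1/n\<close>.
\<close>

section \<open>The AUC as the mean of an antisymmetric kernel\<close>

lemma integrable_sgn_diff:
  assumes "real_distribution F" "real_distribution G"
  shows "integrable (F \<Otimes>\<^sub>M G) (\<lambda>(x, y). sgn (y - x))"
proof -
  interpret F: real_distribution F by fact
  interpret G: real_distribution G by fact
  interpret pair_prob_space F G ..
  show ?thesis
    by (rule P.integrable_const_bound[where B = 1]) (auto simp: sgn_if)
qed

text \<open>Pointwise, \<open>sgn (y - x)\<close> is twice the indicator of \<open>x < y\<close>
  plus the indicator of \<open>x = y\<close> minus 1. The weight 1/2 on ties is thus exactly what
  makes the kernel antisymmetric.\<close>

lemma auc_eq_integral_sgn: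
  assumes "real_distribution F" "real_distribution G"
  shows "auc (F, G) = 1 / 2 + 1 / 2 * (\<integral>(x, y). sgn (y - x) \<partial>(F \<Otimes>\<^sub>M G))"
proof -
  interpret F: real_distribution F by fact
  interpret G: real_distribution G by fact
  interpret pair_prob_space F G ..
  have sets_FG: "sets (F \<Otimes>\<^sub>M G) = sets (borel \<Otimes>\<^sub>M borel)"
    by (rule sets_pair_measure_cong) auto
  have L: "{(x::real, y). x < y} \<in> sets (F \<Otimes>\<^sub>M G)"
    and E: "{(x::real, y). x = y} \<in> sets (F \<Otimes>\<^sub>M G)"
    unfolding sets_FG borel_prod case_prod_beta
    by (intro borel_open borel_closed open_Collect_less closed_Collect_eq continuous_intros)+
  have "(\<integral>(x, y). sgn (y - x) \<partial>(F \<Otimes>\<^sub>M G))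
      = (\<integral>p. 2 * indicator {(x, y). x < y} p + indicator {(x, y). x = y} p - 1 \<partial>(F \<Otimes>\<^sub>M G))"
    by (rule Bochner_Integration.integral_cong) (auto simp: indicator_def sgn_if)
  also have "\<dots> = 2 * P.prob {(x, y). x < y} + P.prob {(x, y). x = y} - 1"
    using L E by (simp add: P.prob_space P.emeasure_eq_measure)
  finally show ?thesis
    by (simp add: auc_def field_simps)
qed

lemma integral_sgn_diff_swap:
  assumes "real_distribution F" "real_distribution G"
  shows "(\<integral>(x, y). sgn (y - x) \<partial>(G \<Otimes>\<^sub>M F)) = - (\<integral>(x, y). sgn (y - x) \<partial>(F \<Otimes>\<^sub>M G))"
proof -
  interpret F: real_distribution F by fact
  interpret G: real_distribution G by fact
  interpret pair_prob_space F G ..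
  have "(\<integral>(x, y). sgn (y - x) \<partial>(G \<Otimes>\<^sub>M F))
      = (\<integral>(x, y). (case (y, x) of (x, y) \<Rightarrow> - sgn (y - x)) \<partial>(G \<Otimes>\<^sub>M F))"
    by (rule Bochner_Integration.integral_cong) (auto simp: sgn_if)
  also have "\<dots> = (\<integral>(x, y). - sgn (y - x) \<partial>(F \<Otimes>\<^sub>M G))"
    by (rule integral_product_swap) measurable
  also have "\<dots> = - (\<integral>(x, y). sgn (y - x) \<partial>(F \<Otimes>\<^sub>M G))"
    unfolding case_prod_beta by simp
  finally show ?thesis .
qed

lemma auc_same:
  assumes "real_distribution F"
  shows "auc (F, F) = 1 / 2"
  using integral_sgn_diff_swap[OF assms assms] auc_eq_integral_sgn[OF assms assms] by simp

section \<open>Monotone likelihood ratios\<close>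

text \<open>Clears denominators when infinite ratios may occur. The assumption
  \<open>a > 0 \<or> b > 0\<close> rules out 0/0 on the left, which \<open>ennreal\<close> evaluates
  to 0; so \<open>a = 0\<close> would make the left ratio infinite, against a finite right ratio
  when \<open>c > 0\<close>.\<close>

lemma ennreal_divide_le_imp_cross_le:
  fixes a b c d :: real
  assumes "0 \<le> a" "0 \<le> b" "0 \<le> c" "0 \<le> d" "a > 0 \<or> b > 0"
    and le: "ennreal b / ennreal a \<le> ennreal d / ennreal c"
  shows "b * c \<le> a * d"
proof (cases "c = 0")
  case False
  then have "c > 0" using assms by simp
  have "a > 0"
  proof (rule ccontr)
    assume "\<not> a > 0"
    then have "a = 0" "b > 0" using assms by auto
    then have "\<top> \<le> ennreal d / ennreal c"
      using le by (simp add: ennreal_divide_zero)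
    with \<open>c > 0\<close> \<open>0 \<le> d\<close> show False
      by (simp add: divide_ennreal top_unique)
  qed
  with le \<open>c > 0\<close> assms have "b / a \<le> d / c"
    by (simp add: divide_ennreal)
  with \<open>a > 0\<close> \<open>c > 0\<close> show ?thesis
    by (simp add: field_simps)
qed (use assms in simp)

text \<open>Monotonicity enters as an inequality between cross products instead of ratios. This
  avoids division by zero and lets a decreasing ratio be treated by exchanging \<open>f\<close> and
  \<open>g\<close>.\<close>

lemma density_eq_if_cross_le:
  fixes f g :: "real \<Rightarrow> real"
  assumes "sigma_finite_measure \<mu>" and sets: "sets \<mu> = sets borel"
    and fm: "f \<in> borel_measurable borel" and gm: "g \<in> borel_measurable borel"
    and f0: "\<And>x. 0 \<le> f x" and g0: "\<And>x. 0 \<le> g x"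
    and F: "real_distribution (density \<mu> f)" and G: "real_distribution (density \<mu> g)"
    and cross: "\<And>x y. x < y \<Longrightarrow> g x * f y \<le> f x * g y"
    and zero: "(\<integral>(x, y). sgn (y - x) \<partial>(density \<mu> f \<Otimes>\<^sub>M density \<mu> g)) = 0"
  shows "density \<mu> f = density \<mu> g"
proof -
  interpret mu: sigma_finite_measure \<mu> by fact
  interpret F: real_distribution "density \<mu> f" by fact
  interpret G: real_distribution "density \<mu> g" by fact
  interpret mumu: pair_sigma_finite \<mu> \<mu> ..
  note [measurable_cong] = sets
  note [measurable] = fm gm
  \<comment> \<open>Stated for arbitrary \<open>a\<close> and \<open>b\<close> because both orders
    of \<open>f\<close> and \<open>g\<close> occur below. That \<open>density \<mu> b\<close> is a
    distribution supplies the sigma-finiteness demanded by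
    \<open>pair_measure_density\<close>.\<close>
  have density2: "density \<mu> a \<Otimes>\<^sub>M density \<mu> b = density (\<mu> \<Otimes>\<^sub>M \<mu>) (\<lambda>(x, y). ennreal (a x * b y))"
    if [measurable]: "a \<in> borel_measurable borel" "b \<in> borel_measurable borel"
      and "\<And>x. 0 \<le> a x" "\<And>x. 0 \<le> b x" "real_distribution (density \<mu> b)"
    for a b :: "real \<Rightarrow> real"
  proof -
    interpret b: real_distribution "density \<mu> b" by fact
    have "density \<mu> a \<Otimes>\<^sub>M density \<mu> b = density (\<mu> \<Otimes>\<^sub>M \<mu>) (\<lambda>(x, y). ennreal (a x) * ennreal (b y))"
      by (rule pair_measure_density) (auto intro: mu.sigma_finite_measure_axioms b.sigma_finite_measure_axioms)
    then show ?thesis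
      using that by (simp add: ennreal_mult)
  qed
  have int: "integrable (\<mu> \<Otimes>\<^sub>M \<mu>) (\<lambda>(x, y). a x * b y * sgn (y - x))"
    and eq: "(\<integral>(x, y). sgn (y - x) \<partial>(density \<mu> a \<Otimes>\<^sub>M density \<mu> b))
      = (\<integral>(x, y). a x * b y * sgn (y - x) \<partial>(\<mu> \<Otimes>\<^sub>M \<mu>))"
    if [measurable]: "a \<in> borel_measurable borel" "b \<in> borel_measurable borel"
      and nn: "\<And>x. 0 \<le> a x" "\<And>x. 0 \<le> b x"
      and rd: "real_distribution (density \<mu> a)" "real_distribution (density \<mu> b)"
    for a b :: "real \<Rightarrow> real"
    using integrable_sgn_diff[OF rd] nn unfolding atomize_conj density2[OF that(1-4,6)]
    by (simp_all add: integrable_real_density integral_real_density case_prod_beta')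
  let ?D = "\<lambda>(x, y). (f x * g y - g x * f y) * sgn (y - x)"
  have D: "?D = (\<lambda>p. (case p of (x, y) \<Rightarrow> f x * g y * sgn (y - x)) - (case p of (x, y) \<Rightarrow> g x * f y * sgn (y - x)))"
    by (auto simp: algebra_simps)
  have iD: "integrable (\<mu> \<Otimes>\<^sub>M \<mu>) ?D"
    unfolding D by (intro Bochner_Integration.integrable_diff int fm gm f0 g0 F G)
  have "integral\<^sup>L (\<mu> \<Otimes>\<^sub>M \<mu>) ?D = (\<integral>(x, y). sgn (y - x) \<partial>(density \<mu> f \<Otimes>\<^sub>M density \<mu> g))
      - (\<integral>(x, y). sgn (y - x) \<partial>(density \<mu> g \<Otimes>\<^sub>M density \<mu> f))"
    unfolding D eq[OF fm gm f0 g0 F G] eq[OF gm fm g0 f0 G F]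
    by (intro Bochner_Integration.integral_diff int fm gm f0 g0 F G)
  also have "\<dots> = 0"
    using zero integral_sgn_diff_swap[OF F G] by simp
  finally have "integral\<^sup>L (\<mu> \<Otimes>\<^sub>M \<mu>) ?D = 0" .
  \<comment> \<open>Off the diagonal the bracket and the sign change together: \<open>cross\<close>
    is used in one order for each side.\<close>
  moreover have "0 \<le> ?D p" for p
    using cross[of "fst p" "snd p"] cross[of "snd p" "fst p"]
    by (auto simp: case_prod_beta sgn_if algebra_simps)
  ultimately have "AE p in \<mu> \<Otimes>\<^sub>M \<mu>. ?D p = 0"
    using integral_nonneg_eq_0_iff_AE[OF iD] by blast
  \<comment> \<open>On the diagonal, which atoms of \<open>\<mu>\<close> may charge,
    \<open>sgn\<close> vanishes and gives no information; there the two products agree by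
    commutativity.\<close>
  then have "AE p in \<mu> \<Otimes>\<^sub>M \<mu>. f (fst p) * g (snd p) = g (fst p) * f (snd p)"
    by eventually_elim (auto simp: sgn_if split: if_splits)
  from mumu.AE_pair[OF this] have cross_AE: "AE x in \<mu>. AE y in \<mu>. f x * g y = g x * f y"
    by simp
  have [simp]: "(\<integral>y. f y \<partial>\<mu>) = 1" "(\<integral>y. g y \<partial>\<mu>) = 1"
    using F.prob_space G.prob_space f0 g0
      integral_real_density[of f \<mu> "\<lambda>_. 1"] integral_real_density[of g \<mu> "\<lambda>_. 1"]
    by auto
  \<comment> \<open>For fixed \<open>x\<close>, integrating over \<open>y\<close> removes the second
    factors, since both densities have total mass 1.\<close>
  from cross_AE have "AE x in \<mu>. f x = g x"
  proof eventually_elim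
    case (elim x)
    then have "(\<integral>y. f x * g y \<partial>\<mu>) = (\<integral>y. g x * f y \<partial>\<mu>)"
      by (intro integral_cong_AE) auto
    then show ?case by simp
  qed
  then show ?thesis
    by (intro density_cong) auto
qed

text \<open>Off \<open>A\<close> both densities vanish, so the cross inequality is trivial there and
  monotonicity on \<open>A\<close> suffices. An increasing ratio gives it for the densities as they
  stand, a decreasing one for the exchanged pair; hence both \<open>zero\<close> and
  \<open>zero'\<close>.\<close>

lemma mlr_pairs_auc_half_imp_eq:
  assumes "(F1, F2) \<in> mlr_pairs" "auc (F1, F2) = 1 / 2"
  shows "F1 = F2"
proof -
  obtain \<mu> and f :: "nat \<Rightarrow> real \<Rightarrow> real" where
    rd: "real_distribution F1" "real_distribution F2"
    and sf: "sigma_finite_measure \<mu>" and sets: "sets \<mu> = sets borel"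
    and fm: "f 1 \<in> borel_measurable borel" "f 2 \<in> borel_measurable borel"
    and f0: "\<And>x. 0 \<le> f 1 x" "\<And>x. 0 \<le> f 2 x"
    and F1: "F1 = density \<mu> (f 1)" and F2: "F2 = density \<mu> (f 2)"
    and mlr: "mlr_family {1, 2} f"
    using assms(1) unfolding mlr_pairs_def distribution_pairs_def by auto
  have zero: "(\<integral>(x, y). sgn (y - x) \<partial>(F1 \<Otimes>\<^sub>M F2)) = 0"
    using assms(2) auc_eq_integral_sgn[OF rd] by simp
  have zero': "(\<integral>(x, y). sgn (y - x) \<partial>(F2 \<Otimes>\<^sub>M F1)) = 0"
    using zero integral_sgn_diff_swap[OF rd] by simp
  define A where "A = {x. f 1 x > 0 \<or> f 2 x > 0}"
  define r where "r = (\<lambda>x. ennreal (f 2 x) / ennreal (f 1 x))"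
  have outside: "f 1 x = 0 \<and> f 2 x = 0" if "x \<notin> A" for x
    using that f0[of x] by (auto simp: A_def not_less intro: antisym)
  have "mono_on A r \<or> antimono_on A r"
    using mlr by (simp add: mlr_family_def Let_def A_def r_def)
  then show ?thesis
  proof
    assume m: "mono_on A r"
    have "f 2 x * f 1 y \<le> f 1 x * f 2 y" if "x < y" for x y
    proof (cases "x \<in> A \<and> y \<in> A")
      case True
      then have "r x \<le> r y" using m \<open>x < y\<close> by (auto intro: mono_onD)
      then show ?thesis
        using True f0 unfolding r_def A_def by (intro ennreal_divide_le_imp_cross_le) auto
    qed (use outside in auto)
    then show ?thesis
      unfolding F1 F2
      using density_eq_if_cross_le[OF sf sets fm f0] rd zero by (simp add: F1 F2)
  next
    assume m: "antimono_on A r"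
    have "f 1 x * f 2 y \<le> f 2 x * f 1 y" if "x < y" for x y
    proof (cases "x \<in> A \<and> y \<in> A")
      case True
      then have "r y \<le> r x" using m \<open>x < y\<close> by (auto simp: monotone_on_def)
      then have "f 2 y * f 1 x \<le> f 1 y * f 2 x"
        using True f0 unfolding r_def A_def by (intro ennreal_divide_le_imp_cross_le) auto
      then show ?thesis by (simp add: mult.commute)
    qed (use outside in auto)
    then show ?thesis
      unfolding F1 F2
      using density_eq_if_cross_le[OF sf sets fm(2,1) f0(2,1)] rd zero' by (simp add: F1 F2)
  qed
qed

section \<open>Consistency of the empirical AUC\<close>

lemma integral_PiM_component:
  fixes f :: "'a \<Rightarrow> real"
  assumes "prob_space M" "f \<in> borel_measurable M"
  shows "(\<integral>x. f (x i) \<partial>(\<Pi>\<^sub>M i\<in>UNIV. M)) = (\<integral>a. f a \<partial>M)"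
proof -
  have "(\<integral>a. f a \<partial>M) = (\<integral>a. f a \<partial>distr (\<Pi>\<^sub>M i\<in>UNIV. M) M (\<lambda>x. x i))"
    using assms by (subst distr_PiM_component) auto
  also have "\<dots> = (\<integral>x. f (x i) \<partial>(\<Pi>\<^sub>M i\<in>UNIV. M))"
    using assms by (intro integral_distr) auto
  finally show ?thesis ..
qed

text \<open>Distinct coordinates are independent under a product measure, so the expectation of the
  product factorizes.\<close>

lemma integral_PiM_two_components:
  fixes f g :: "'a \<Rightarrow> real"
  assumes "prob_space M" "integrable M f" "integrable M g" "i \<noteq> j"
  shows "(\<integral>x. f (x i) * g (x j) \<partial>(\<Pi>\<^sub>M i\<in>UNIV. M)) = (\<integral>a. f a \<partial>M) * (\<integral>a. g a \<partial>M)"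
proof -
  interpret P: prob_space "\<Pi>\<^sub>M i\<in>(UNIV :: 'b set). M"
    by (rule prob_space_PiM) (rule assms)
  have fg [measurable]: "f \<in> borel_measurable M" "g \<in> borel_measurable M"
    using assms by auto
  have "P.indep_vars (\<lambda>_. M) (\<lambda>i x. x i) UNIV"
    using distr_PiM_component[of "UNIV :: 'b set" "\<lambda>_. M"] assms(1)
    by (subst P.indep_vars_iff_distr_eq_PiM') (auto simp: restrict_UNIV)
  then have "P.indep_vars (\<lambda>_. M) (\<lambda>i x. x i) {i, j}"
    by (rule P.indep_vars_subset) simp
  \<comment> \<open>One family indexed by \<open>k\<close> encodes both functions: \<open>f\<close>
    at \<open>i\<close>, and \<open>g\<close> at \<open>j\<close> because
    \<open>i \<noteq> j\<close>.\<close>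
  then have ind: "P.indep_vars (\<lambda>_. borel) (\<lambda>k x. (if k = i then f else g) (x k)) {i, j}"
    by (rule P.indep_vars_compose2) auto
  have int: "integrable (\<Pi>\<^sub>M i\<in>(UNIV :: 'b set). M) (\<lambda>x. h (x k))" if "integrable M h" for h :: "'a \<Rightarrow> real" and k
  proof -
    have "integrable (distr (\<Pi>\<^sub>M i\<in>(UNIV :: 'b set). M) M (\<lambda>x. x k)) h"
      using that assms by (subst distr_PiM_component) auto
    then show ?thesis
      by (rule integrable_distr[rotated]) auto
  qed
  have "(\<integral>x. (\<Prod>k\<in>{i, j}. (if k = i then f else g) (x k)) \<partial>(\<Pi>\<^sub>M i\<in>UNIV. M))
      = (\<Prod>k\<in>{i, j}. \<integral>x. (if k = i then f else g) (x k) \<partial>(\<Pi>\<^sub>M i\<in>UNIV. M))"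
    by (rule P.indep_vars_lebesgue_integral[OF _ ind]) (auto intro: int assms)
  then show ?thesis
    using assms by (simp add: integral_PiM_component)
qed

text \<open>The squared double sum is a quadruple sum. Terms with \<open>i \<noteq> i'\<close> and
  \<open>j \<noteq> j'\<close> have mean zero, all others have mean at most 1, and at most
  \<open>m * n * (m + n)\<close> of the latter exist.\<close>

lemma second_moment_two_sample_mean:
  fixes k :: "'a \<Rightarrow> 'b \<Rightarrow> real"
  assumes M: "prob_space M" and N: "prob_space N"
    and km [measurable]: "(\<lambda>(x, y). k x y) \<in> borel_measurable (M \<Otimes>\<^sub>M N)"
    and bound: "\<And>x y. \<bar>k x y\<bar> \<le> 1"
    and mean: "(\<integral>(x, y). k x y \<partial>(M \<Otimes>\<^sub>M N)) = 0"
    and mn: "m > 0" "n > 0"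
  defines "S \<equiv> (\<Pi>\<^sub>M i\<in>(UNIV :: nat set). M) \<Otimes>\<^sub>M (\<Pi>\<^sub>M j\<in>(UNIV :: nat set). N)"
  shows "(\<integral>(x, y). ((\<Sum>i<m. \<Sum>j<n. k (x i) (y j)) / (real m * real n))\<^sup>2 \<partial>S) \<le> 1 / real m + 1 / real n"
proof -
  interpret M: prob_space M by fact
  interpret N: prob_space N by fact
  interpret MN: pair_prob_space M N ..
  interpret PM: prob_space "\<Pi>\<^sub>M i\<in>(UNIV :: nat set). M" by (rule prob_space_PiM) (rule M)
  interpret PN: prob_space "\<Pi>\<^sub>M i\<in>(UNIV :: nat set). N" by (rule prob_space_PiM) (rule N)
  interpret S: pair_prob_space "\<Pi>\<^sub>M i\<in>(UNIV :: nat set). M" "\<Pi>\<^sub>M i\<in>(UNIV :: nat set). N" ..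
  have Sm [measurable]: "(\<lambda>p. k (fst p i) (snd p j)) \<in> borel_measurable S" for i j
    unfolding S_def by (rule measurable_compose[OF _ km, where f = "\<lambda>p. (fst p i, snd p j)", simplified]) measurable
  have bound2: "\<bar>k a b * k c d\<bar> \<le> 1" for a b c d
    using mult_mono[OF bound bound, of a b c d] by (simp add: abs_mult mult.commute)
  have int: "integrable S (\<lambda>p. k (fst p i) (snd p j) * k (fst p i') (snd p j'))" for i j i' j'
    using bound2 by (intro S.P.integrable_const_bound[where B = 1, folded S_def]) auto
  define E where "E = (\<lambda>i j i' j'. \<integral>p. k (fst p i) (snd p j) * k (fst p i') (snd p j') \<partial>S)"
  \<comment> \<open>Adding the two indicators counts terms sharing both indices twice; this harmless
    excess makes the bound easy to sum.\<close>
  have E_le: "E i j i' j' \<le> of_bool (i = i') + of_bool (j = j')" for i j i' j'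
  proof (cases "i = i' \<or> j = j'")
    case True
    have "E i j i' j' \<le> (\<integral>p. 1 \<partial>S)"
      unfolding E_def using int bound2
      by (intro integral_mono) (auto simp: S_def abs_le_iff)
    also have "\<dots> = 1"
      by (simp add: S_def S.P.prob_space)
    finally show ?thesis using True by auto
  next
    case False
    \<comment> \<open>The projection of the kernel onto the first sample. Integrating out the second
      sample turns the term into a product of \<open>\<phi>\<close> at two independent coordinates,
      and \<open>\<phi>\<close> has mean zero.\<close>
    define \<phi> where "\<phi> = (\<lambda>a. \<integral>b. k a b \<partial>N)"
    have iMN: "integrable (M \<Otimes>\<^sub>M N) (\<lambda>(x, y). k x y)"
      using bound by (intro MN.P.integrable_const_bound[where B = 1]) auto
    have \<phi>: "integrable M \<phi>" "(\<integral>a. \<phi> a \<partial>M) = 0"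
      using MN.integrable_fst'[OF iMN] MN.integral_fst'[OF iMN] mean by (simp_all add: \<phi>_def)
    have ik: "integrable N (k a)" if "a \<in> space M" for a
      using that bound measurable_Pair2[OF km that]
      by (intro N.integrable_const_bound[where B = 1]) auto
    have "E i j i' j' = (\<integral>x. \<integral>y. k (x i) (y j) * k (x i') (y j') \<partial>(\<Pi>\<^sub>M j\<in>UNIV. N) \<partial>(\<Pi>\<^sub>M i\<in>UNIV. M))"
      unfolding E_def using S.integral_fst'[OF int[unfolded S_def, of i j i' j']] by (simp add: S_def)
    also have "\<dots> = (\<integral>x. \<phi> (x i) * \<phi> (x i') \<partial>(\<Pi>\<^sub>M i\<in>UNIV. M))"
      using False unfolding \<phi>_def
      by (intro Bochner_Integration.integral_cong refl integral_PiM_two_components N ik)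
        (auto simp: space_PiM)
    also have "\<dots> = 0"
      using False \<phi> by (subst integral_PiM_two_components[OF M]) auto
    finally show ?thesis using False by simp
  qed
  have "(\<integral>(x, y). ((\<Sum>i<m. \<Sum>j<n. k (x i) (y j)) / (real m * real n))\<^sup>2 \<partial>S)
      = (\<integral>p. (\<Sum>i<m. \<Sum>j<n. \<Sum>i'<m. \<Sum>j'<n. k (fst p i) (snd p j) * k (fst p i') (snd p j'))
             / (real m * real n)\<^sup>2 \<partial>S)"
    \<comment> \<open>Distributing from the right first puts the sums in the order \<open>i\<close>,
      \<open>j\<close>, \<open>i'\<close>, \<open>j'\<close>.\<close>
    unfolding power_divide power2_eq_square[of "sum _ _"] sum_distrib_right
    unfolding sum_distrib_left case_prod_beta ..
  also have "\<dots> = (\<Sum>i<m. \<Sum>j<n. \<Sum>i'<m. \<Sum>j'<n. E i j i' j') / (real m * real n)\<^sup>2"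
    using int by (simp add: E_def)
  also have "\<dots> \<le> (\<Sum>i<m. \<Sum>j<n. \<Sum>i'<m. \<Sum>j'<n. of_bool (i = i') + of_bool (j = j')) / (real m * real n)\<^sup>2"
    by (intro divide_right_mono sum_mono E_le) auto
  also have "(\<Sum>i<m. \<Sum>j<n. \<Sum>i'<m. \<Sum>j'<n. of_bool (i = i') + of_bool (j = j'))
      = real m * real n * (real m + real n)"
  proof -
    have "(\<Sum>i'<m. \<Sum>j'<n. of_bool (i = i') + of_bool (j = j')) = real m + real n" if "i < m" "j < n" for i j
      using that by (simp add: sum.distrib flip: sum_distrib_left)
    then show ?thesis by simp
  qed
  also have "\<dots> / (real m * real n)\<^sup>2 = 1 / real m + 1 / real n"
    using mn by (simp add: field_simps power2_eq_square)
  finally show ?thesis .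
qed

text \<open>The Chebyshev bound involves the sample sizes only through \<open>1 / m + 1 / n\<close>,
  so it vanishes along the product filter however the two sizes compare.\<close>

lemma detection_functional_empirical_auc: "detection_functional empirical_auc auc"
  unfolding detection_functional_def
proof
  fix FG :: "real measure \<times> real measure" assume "FG \<in> distribution_pairs"
  then obtain F G where FG: "FG = (F, G)" and F: "real_distribution F" and G: "real_distribution G"
    by (auto simp: distribution_pairs_def)
  interpret F: real_distribution F by fact
  interpret G: real_distribution G by fact
  interpret pair_prob_space F G ..
  interpret PF: prob_space "\<Pi>\<^sub>M i\<in>(UNIV :: nat set). F" by (rule prob_space_PiM) unfold_locales
  interpret PG: prob_space "\<Pi>\<^sub>M i\<in>(UNIV :: nat set). G" by (rule prob_space_PiM) unfold_locales
  interpret S: pair_prob_space "\<Pi>\<^sub>M i\<in>(UNIV :: nat set). F" "\<Pi>\<^sub>M i\<in>(UNIV :: nat set). G" ..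
  define S where "S = (\<Pi>\<^sub>M i\<in>(UNIV :: nat set). F) \<Otimes>\<^sub>M (\<Pi>\<^sub>M i\<in>(UNIV :: nat set). G)"
  have S: "sample_space FG = S"
    by (simp add: sample_space_def S_def FG)
  interpret Sp: prob_space S
    unfolding S_def by (rule S.P.prob_space_axioms)
  define c where "c = auc FG"
  \<comment> \<open>The summand of the empirical AUC, written with \<open>sgn\<close> and centred at
    its mean \<open>c\<close>. Its values before centring, like \<open>c\<close>, lie between 0 and
    1, which gives \<open>kb\<close>.\<close>
  define k where "k = (\<lambda>x y :: real. 1 / 2 + 1 / 2 * sgn (y - x) - c)"
  have ik: "integrable (F \<Otimes>\<^sub>M G) (\<lambda>(x, y). sgn (y - x))"
    by (rule integrable_sgn_diff) fact+
  have c: "c = 1 / 2 + 1 / 2 * (\<integral>(x, y). sgn (y - x) \<partial>(F \<Otimes>\<^sub>M G))"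
    unfolding c_def FG by (rule auc_eq_integral_sgn) fact+
  have "\<bar>\<integral>(x, y). sgn (y - x) \<partial>(F \<Otimes>\<^sub>M G)\<bar> \<le> (\<integral>p. 1 \<partial>(F \<Otimes>\<^sub>M G))"
    using integral_abs_bound[of "F \<Otimes>\<^sub>M G" "\<lambda>(x, y). sgn (y - x)"]
    by (rule order_trans, intro integral_mono) (use ik in \<open>auto simp: sgn_if\<close>)
  then have "0 \<le> c" "c \<le> 1"
    unfolding c by (auto simp: P.prob_space)
  then have kb: "\<bar>k x y\<bar> \<le> 1" for x y
    by (auto simp: k_def sgn_if)
  have k0: "(\<integral>(x, y). k x y \<partial>(F \<Otimes>\<^sub>M G)) = 0"
    using ik c unfolding k_def case_prod_beta by (simp add: P.prob_space)
  have km: "(\<lambda>(x, y). k x y) \<in> borel_measurable (F \<Otimes>\<^sub>M G)"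
    unfolding k_def by measurable
  \<comment> \<open>Positive sizes matter: with an empty sample, division by zero makes
    \<open>empirical_auc\<close> equal to 0, and the right side is 0 as well.\<close>
  have D: "empirical_auc m n x y - c = (\<Sum>i<m. \<Sum>j<n. k (x i) (y j)) / (real m * real n)"
    if "m > 0" "n > 0" for m n and x y :: "nat \<Rightarrow> real"
  proof -
    have "(\<Sum>i<m. \<Sum>j<n. k (x i) (y j))
        = (\<Sum>i<m. \<Sum>j<n. (if x i < y j then 1 else if x i = y j then 1 / 2 else 0) - c)"
      by (intro sum.cong refl) (auto simp: k_def sgn_if)
    also have "\<dots> = (\<Sum>i<m. \<Sum>j<n. if x i < y j then 1 else if x i = y j then 1 / 2 else 0)
        - real m * real n * c"
      by (simp add: sum_subtractf)
    finally show ?thesis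
      using that by (simp add: empirical_auc_def field_simps)
  qed
  have Dm [measurable]: "(\<lambda>(x, y). empirical_auc m n x y) \<in> borel_measurable S" for m n
    unfolding empirical_auc_def S_def by measurable
  have E0: "empirical_auc m n x y \<ge> 0" "empirical_auc m n x y \<le> 1" for m n x y
  proof -
    show "empirical_auc m n x y \<ge> 0"
      unfolding empirical_auc_def by (intro divide_nonneg_nonneg sum_nonneg) auto
    have "(\<Sum>i<m. \<Sum>j<n. if x i < y j then 1 else if x i = y j then 1 / 2 else 0)
        \<le> (\<Sum>i<m. \<Sum>j<n. 1 :: real)"
      by (intro sum_mono) auto
    then show "empirical_auc m n x y \<le> 1"
      unfolding empirical_auc_def by (cases "m = 0 \<or> n = 0") (auto simp: divide_le_eq)
  qed
  have tail: "measure S {(x, y) \<in> space S. \<bar>empirical_auc m n x y - c\<bar> > \<epsilon>}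
      \<le> (1 / real m + 1 / real n) / \<epsilon>\<^sup>2" if "\<epsilon> > 0" "m > 0" "n > 0" for m n \<epsilon>
  proof -
    let ?f = "\<lambda>(x, y). empirical_auc m n x y - c"
    have fm [measurable]: "?f \<in> borel_measurable S"
      using Dm[of m n] unfolding case_prod_beta by measurable
    have fb: "\<bar>?f p\<bar> \<le> 1" for p
      using E0[of m n "fst p" "snd p"] \<open>0 \<le> c\<close> \<open>c \<le> 1\<close> by (auto simp: case_prod_beta)
    \<comment> \<open>Convergence in probability uses a strict tail, the second moment inequality a
      weak one.\<close>
    have "measure S {(x, y) \<in> space S. \<bar>empirical_auc m n x y - c\<bar> > \<epsilon>}
        \<le> measure S {p \<in> space S. \<bar>?f p\<bar> \<ge> \<epsilon>}"
      by (rule Sp.finite_measure_mono) auto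
    also have "\<dots> \<le> (\<integral>p. (?f p)\<^sup>2 \<partial>S) / \<epsilon>\<^sup>2"
    proof (rule Sp.second_moment_method[OF fm _ that(1)])
      show "integrable S (\<lambda>p. (?f p)\<^sup>2)"
        using fb fm by (intro Sp.integrable_const_bound[where B = 1] AE_I2 borel_measurable_power)
          (simp_all add: abs_square_le_1)
    qed
    also have "(\<integral>p. (?f p)\<^sup>2 \<partial>S) \<le> 1 / real m + 1 / real n"
      using second_moment_two_sample_mean[OF F.prob_space_axioms G.prob_space_axioms km kb k0 that(2,3)] that
      unfolding S_def[symmetric] by (simp add: D case_prod_beta')
    finally show ?thesis
      using that by (simp add: divide_right_mono)
  qed
  show "probability_limit empirical_auc FG (auc FG)"
    unfolding probability_limit_def S c_def[symmetric]
  proof (intro conjI allI impI Dm)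
    fix \<epsilon> :: real assume "\<epsilon> > 0"
    have "((\<lambda>p. 1 / real (fst p)) \<longlongrightarrow> 0) (sequentially \<times>\<^sub>F sequentially)"
      by (rule filterlim_compose[OF lim_1_over_n filterlim_fst])
    moreover have "((\<lambda>p. 1 / real (snd p)) \<longlongrightarrow> 0) (sequentially \<times>\<^sub>F sequentially)"
      by (rule filterlim_compose[OF lim_1_over_n filterlim_snd])
    ultimately have lim: "((\<lambda>p. (1 / real (fst p) + 1 / real (snd p)) / \<epsilon>\<^sup>2) \<longlongrightarrow> (0 + 0) / \<epsilon>\<^sup>2) (sequentially \<times>\<^sub>F sequentially)"
      using \<open>\<epsilon> > 0\<close> by (intro tendsto_divide tendsto_add tendsto_const) auto
    \<comment> \<open>\<open>tail\<close> requires both samples to be nonempty, which holds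
      eventually.\<close>
    have "\<forall>\<^sub>F p in sequentially \<times>\<^sub>F sequentially. fst p > 0 \<and> snd p > 0"
      unfolding eventually_prod_filter
      by (intro exI[of _ "\<lambda>n. n > 0"]) (auto intro: eventually_gt_at_top)
    then have le: "\<forall>\<^sub>F p in sequentially \<times>\<^sub>F sequentially.
        (case p of (m, n) \<Rightarrow> measure S {(x, y) \<in> space S. \<bar>empirical_auc m n x y - c\<bar> > \<epsilon>})
          \<le> (1 / real (fst p) + 1 / real (snd p)) / \<epsilon>\<^sup>2"
      by eventually_elim (use tail[OF \<open>\<epsilon> > 0\<close>] in auto)
    show "((\<lambda>(m, n). measure S {(x, y) \<in> space S. \<bar>empirical_auc m n x y - c\<bar> > \<epsilon>}) \<longlongrightarrow> 0)
        (sequentially \<times>\<^sub>F sequentially)"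
    proof (rule tendsto_sandwich[OF _ le tendsto_const])
      show "((\<lambda>p. (1 / real (fst p) + 1 / real (snd p)) / \<epsilon>\<^sup>2) \<longlongrightarrow> 0) (sequentially \<times>\<^sub>F sequentially)"
        using lim by simp
    qed (auto simp: case_prod_beta)
  qed
qed

theorem theorem1:
  shows "detection_coherent equality_null empirical_auc mlr_pairs \<and>
         restricted_blind_spot {F \<in> distribution_pairs. auc F = 1 / 2} equality_null mlr_pairs = {} \<and>
         {(F1, F2) \<in> distribution_pairs. F1 \<noteq> F2} \<inter> mlr_pairs
           = {F \<in> distribution_pairs. auc F \<noteq> 1 / 2} \<inter> mlr_pairs"
proof -
  have null: "auc F = 1 / 2" if "F \<in> equality_null" for F
    using that auc_same by (auto simp: equality_null_def distribution_pairs_def)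
  have blind: "restricted_blind_spot {F \<in> distribution_pairs. auc F = 1 / 2} equality_null mlr_pairs = {}"
    using mlr_pairs_auc_half_imp_eq by (auto simp: restricted_blind_spot_def equality_null_def)
  \<comment> \<open>The witnesses are \<open>auc\<close> for the detection functional and 1/2 for
    its null value.\<close>
  have "detection_coherent equality_null empirical_auc mlr_pairs"
    unfolding detection_coherent_def detection_null_set_def
    using detection_functional_empirical_auc null blind by blast
  \<comment> \<open>From left to right this is the contrapositive of
    \<open>mlr_pairs_auc_half_imp_eq\<close>; from right to left, that of
    \<open>null\<close>.\<close>
  moreover have "{(F1, F2) \<in> distribution_pairs. F1 \<noteq> F2} \<inter> mlr_pairs
      = {F \<in> distribution_pairs. auc F \<noteq> 1 / 2} \<inter> mlr_pairs"
    using mlr_pairs_auc_half_imp_eq null by (auto simp: equality_null_def)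
  ultimately show ?thesis
    using blind by blast
qed

end
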